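(* For every complex matrix $M\in\mathbb{C}^{n\times n}\subset\mathbb{H}^{n\times n}$, $\mathrm{Sdet}(M)=|\det(M)|$, where $\det$ is the usual complex determinant.
   Context: $\mathbb{H}$ is the skew-field of real quaternions $q=a+ib+jc+kd$ with $a,b,c,d\in\mathbb{R}$, $i^2=j^2=k^2=ijk=-1$. Every $M\in\mathbb{H}^{n\times n}$ is uniquely written $M=M_1+jM_2$ with $M_1,M_2\in\mathbb{C}^{n\times n}$ (where $\mathbb{C}=\mathbb{R}+i\mathbb{R}\subset\mathbb{H}$), and its complexification is the complex $2n\times 2n$ matrix $\mathcal{Z}[M]=\begin{pmatrix} M_1 & -M_2^*\\ M_2 & M_1^*\end{pmatrix}$, where $*$ is entrywise complex conjugation. The determinant $\det\mathcal{Z}[M]$ (the $q$-determinant) is real and nonnegative, and the Study determinant is normalized by $\mathrm{Sdet}[M]=\left(\det \mathcal{Z}[M]\right)^{1/2}\ge 0$. *)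

theory Defs
  imports Complex_Main "Jordan_Normal_Form.Determinant"
begin

text \<open>The skew-field of quaternions: \<open>Quat a b c d\<close> stands for \<open>a + ib + jc + kd\<close>.\<close>

datatype quat = Quat (qre: real) (qim_i: real) (qim_j: real) (qim_k: real)

instantiation quat :: division_ring
begin

definition zero_quat :: quat where
  "zero_quat = Quat 0 0 0 0"

definition one_quat :: quat where
  "one_quat = Quat 1 0 0 0"

definition plus_quat :: "quat \<Rightarrow> quat \<Rightarrow> quat" where
  "p + q = Quat (qre p + qre q) (qim_i p + qim_i q) (qim_j p + qim_j q) (qim_k p + qim_k q)"

definition minus_quat :: "quat \<Rightarrow> quat \<Rightarrow> quat" where
  "p - q = Quat (qre p - qre q) (qim_i p - qim_i q) (qim_j p - qim_j q) (qim_k p - qim_k q)"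

definition uminus_quat :: "quat \<Rightarrow> quat" where
  "- q = Quat (- qre q) (- qim_i q) (- qim_j q) (- qim_k q)"

definition times_quat :: "quat \<Rightarrow> quat \<Rightarrow> quat" where
  "p * q = Quat
     (qre p * qre q - qim_i p * qim_i q - qim_j p * qim_j q - qim_k p * qim_k q)
     (qre p * qim_i q + qim_i p * qre q + qim_j p * qim_k q - qim_k p * qim_j q)
     (qre p * qim_j q - qim_i p * qim_k q + qim_j p * qre q + qim_k p * qim_i q)
     (qre p * qim_k q + qim_i p * qim_j q - qim_j p * qim_i q + qim_k p * qre q)"

definition qnorm2 :: "quat \<Rightarrow> real" where
  "qnorm2 q = (qre q)\<^sup>2 + (qim_i q)\<^sup>2 + (qim_j q)\<^sup>2 + (qim_k q)\<^sup>2"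

definition inverse_quat :: "quat \<Rightarrow> quat" where
  "inverse q = Quat (qre q / qnorm2 q) (- qim_i q / qnorm2 q)
     (- qim_j q / qnorm2 q) (- qim_k q / qnorm2 q)"

definition divide_quat :: "quat \<Rightarrow> quat \<Rightarrow> quat" where
  "p div q = p * inverse (q :: quat)"

instance
proof
  fix p q r :: quat
  show "p * q * r = p * (q * r)"
    by (simp add: times_quat_def algebra_simps)
  show "(p + q) * r = p * r + q * r" "p * (q + r) = p * q + p * r"
    by (simp_all add: times_quat_def plus_quat_def algebra_simps)
  show "p div q = p * inverse q"
    by (simp add: divide_quat_def)
  show "inverse (0 :: quat) = 0"
    by (simp add: inverse_quat_def zero_quat_def)
  assume "p \<noteq> 0"
  then have "\<not> (qre p = 0 \<and> qim_i p = 0 \<and> qim_j p = 0 \<and> qim_k p = 0)"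
    by (metis quat.collapse zero_quat_def)
  then have nz: "qnorm2 p \<noteq> 0"
    unfolding qnorm2_def by (smt (verit) zero_le_power2 power2_eq_square mult_eq_0_iff)
  have one: "qre p * qre p / qnorm2 p + qim_i p * qim_i p / qnorm2 p
      + qim_j p * qim_j p / qnorm2 p + qim_k p * qim_k p / qnorm2 p = 1"
    using nz by (simp add: qnorm2_def power2_eq_square flip: add_divide_distrib)
  show "inverse p * p = 1" "p * inverse p = 1"
    using one by (simp_all add: times_quat_def inverse_quat_def one_quat_def mult.commute)
qed (simp_all add: zero_quat_def one_quat_def plus_quat_def minus_quat_def uminus_quat_def
      times_quat_def quat.expand)

end

definition quat_i :: quat where "quat_i = Quat 0 1 0 0"
definition quat_j :: quat where "quat_j = Quat 0 0 1 0"
definition quat_k :: quat where "quat_k = Quat 0 0 0 1"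

lemma quat_units:
  "quat_i * quat_i = - 1" "quat_j * quat_j = - 1" "quat_k * quat_k = - 1"
  "quat_i * quat_j * quat_k = - 1"
  by (simp_all add: quat_i_def quat_j_def quat_k_def times_quat_def one_quat_def uminus_quat_def)

definition quat_of_complex :: "complex \<Rightarrow> quat" where
  "quat_of_complex z = Quat (Re z) (Im z) 0 0"

text \<open>Since \<open>j (c + i d) = j c - k d\<close>, the decomposition \<open>q = z\<^sub>1 + j z\<^sub>2\<close> of
  \<open>q = a + ib + jc + kd\<close> has \<open>z\<^sub>1 = a + ib\<close> and \<open>z\<^sub>2 = c - id\<close>.\<close>

definition quat_part1 :: "quat \<Rightarrow> complex" where
  "quat_part1 q = Complex (qre q) (qim_i q)"

definition quat_part2 :: "quat \<Rightarrow> complex" where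
  "quat_part2 q = Complex (qim_j q) (- qim_k q)"

lemma quat_decomposition:
  "q = quat_of_complex z1 + quat_j * quat_of_complex z2
     \<longleftrightarrow> z1 = quat_part1 q \<and> z2 = quat_part2 q"
  by (cases q) (auto simp: quat_of_complex_def quat_j_def quat_part1_def quat_part2_def
      times_quat_def plus_quat_def complex_eq_iff)

lemma mat_quat_decomposition:
  assumes "M \<in> carrier_mat n n" "M1 \<in> carrier_mat n n" "M2 \<in> carrier_mat n n"
  shows "M = map_mat quat_of_complex M1 + quat_j \<cdot>\<^sub>m map_mat quat_of_complex M2
     \<longleftrightarrow> M1 = map_mat quat_part1 M \<and> M2 = map_mat quat_part2 M"
  using assms by (auto simp: mat_eq_iff quat_decomposition)

definition complexification :: "quat mat \<Rightarrow> complex mat" where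
  "complexification M =
     (let M1 = map_mat quat_part1 M; M2 = map_mat quat_part2 M
      in four_block_mat M1 (- map_mat cnj M2) M2 (map_mat cnj M1))"

definition Sdet :: "quat mat \<Rightarrow> real" where
  "Sdet M = sqrt (Re (det (complexification M)))"

text \<open>The determinant is real, so taking its real part in \<open>Sdet\<close> loses nothing.\<close>

lemma det_complexification_real:
  assumes M: "M \<in> carrier_mat n n"
  shows "det (complexification M) \<in> \<real>"
proof -
  define A where "A = map_mat quat_part1 M"
  define B where "B = map_mat quat_part2 M"
  define A' where "A' = map_mat cnj A"
  define B' where "B' = map_mat cnj B"
  have c: "A \<in> carrier_mat n n" "B \<in> carrier_mat n n"
    "A' \<in> carrier_mat n n" "B' \<in> carrier_mat n n"
    using M by (auto simp: A_def B_def A'_def B'_def)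
  define Z where "Z = complexification M"
  have Z: "Z = four_block_mat A (- B') B A'"
    by (simp add: Z_def complexification_def A_def B_def A'_def B'_def Let_def)
  have Zc: "Z \<in> carrier_mat (n + n) (n + n)"
    unfolding Z using c by simp
  have cnjZ: "map_mat cnj Z = four_block_mat A' (- B) B' A"
    unfolding Z by (rule eq_matI) (use c in \<open>auto simp: A'_def B'_def\<close>)
  define J :: "complex mat" where "J = four_block_mat (0\<^sub>m n n) (- 1\<^sub>m n) (1\<^sub>m n) (0\<^sub>m n n)"
  have Jc: "J \<in> carrier_mat (n + n) (n + n)"
    unfolding J_def by simp
  have JZ: "J * Z = map_mat cnj Z * J"
    unfolding cnjZ unfolding Z J_def using c
    by (subst (1 2) mult_four_block_mat[where ?nr1.0 = n and ?n1.0 = n and ?n2.0 = n and ?nr2.0 = n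
          and ?nc1.0 = n and ?nc2.0 = n]) auto
  have mJ: "- J = four_block_mat (0\<^sub>m n n) (1\<^sub>m n) (- 1\<^sub>m n) (0\<^sub>m n n)"
    unfolding J_def by (rule eq_matI) auto
  have m0: "- 0\<^sub>m n n = (0\<^sub>m n n :: complex mat)"
    by auto
  have JJ: "J * (- J) = 1\<^sub>m (n + n)"
    unfolding mJ unfolding J_def
    by (subst mult_four_block_mat[where ?nr1.0 = n and ?n1.0 = n and ?n2.0 = n and ?nr2.0 = n
          and ?nc1.0 = n and ?nc2.0 = n]) (auto simp: m0)
  have "det J * det (- J) = 1"
    using det_mult[OF Jc, of "- J"] JJ Jc by simp
  then have nz: "det J \<noteq> 0" by auto
  have "det J * det Z = det (map_mat cnj Z) * det J"
    using JZ det_mult[OF Jc Zc] det_mult[of "map_mat cnj Z" "n + n" J] Zc Jc by (metis map_carrier_mat)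
  then have "det Z = det (map_mat cnj Z)"
    using nz by (metis mult.commute mult_right_cancel)
  also have "\<dots> = cnj (det Z)"
  proof -
    interpret cnj: comm_ring_hom cnj
      by unfold_locales auto
    show ?thesis by (rule cnj.hom_det)
  qed
  finally show ?thesis
    unfolding Z_def by (metis Reals_cnj_iff)
qed

end

theory Submission imports Defs begin

text \<open>A complex matrix has no \<open>quat_j\<close> component, so its complexification is
  block diagonal with blocks \<open>M\<close> and its conjugate
  (\<open>complexification_of_complex\<close>). Conjugation is a ring homomorphism, hence commutes
  with \<open>det\<close> (\<open>det_map_mat_cnj\<close>). The determinant is therefore
  \<open>det M\<close> times its conjugate, the squared modulus, whose root is
  \<open>cmod (det M)\<close>.\<close>

lemma det_map_mat_cnj: "det (map_mat cnj A) = cnj (det A)"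
proof -
  interpret cnj: comm_ring_hom cnj
    by unfold_locales auto
  show ?thesis by (rule cnj.hom_det)
qed

lemma complexification_of_complex:
  assumes "M \<in> carrier_mat n n"
  shows "complexification (map_mat quat_of_complex M) =
    four_block_mat M (0\<^sub>m n n) (0\<^sub>m n n) (map_mat cnj M)"
proof -
  have part1: "map_mat quat_part1 (map_mat quat_of_complex M) = M"
    by (rule eq_matI) (auto simp: quat_part1_def quat_of_complex_def)
  have part2: "map_mat quat_part2 (map_mat quat_of_complex M) = 0\<^sub>m n n"
    using assms by (auto simp: mat_eq_iff quat_part2_def quat_of_complex_def complex_eq_iff)
  \<comment> \<open>This is the upper right block once \<open>part2\<close> has been
    substituted.\<close>
  have "- map_mat cnj (0\<^sub>m n n) = 0\<^sub>m n n"
    by (rule eq_matI) auto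
  then show ?thesis
    by (simp only: complexification_def Let_def part1 part2)
qed

theorem corollary6p3:
  fixes M :: "complex mat" and n :: nat
  assumes "M \<in> carrier_mat n n"
  shows "Sdet (map_mat quat_of_complex M) = cmod (det M)"
proof -
  have "det (complexification (map_mat quat_of_complex M)) = det M * det (map_mat cnj M)"
    unfolding complexification_of_complex[OF assms]
    by (rule det_four_block_mat_upper_right_zero) (use assms in auto)
  also have "\<dots> = of_real ((cmod (det M))\<^sup>2)"
    \<comment> \<open>Without \<open>of_real_power\<close> the square stays inside
      \<open>of_real\<close>, the form in which \<open>complex_norm_square\<close> rewrites it to a
      number times its conjugate.\<close>
    by (simp add: det_map_mat_cnj complex_norm_square del: of_real_power)
  finally show ?thesis
    by (simp add: Sdet_def del: of_real_power)
qed

end
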